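(* Let $K\subset\mathcal M(\mathbb R_+)$. Then the following statements are equivalent: (i) $K$ is tight, i.e. $\sup_{\nu\in K}\nu((s,\infty))\to 0$ as $s\to\infty$. (ii) There exists a nondecreasing function $\psi\colon[0,\infty)\to[0,\infty)$ with $\psi(0)=0$, $\psi(s)\to\infty$ as $s\to\infty$ and $$\sup_{\nu\in K}\int_0^\infty\psi(s)\,d\nu(s)<\infty.$$ The function $\psi$ in (ii) can be chosen to be continuous. The function $\psi$ in (ii) can be chosen to be convex if and only if $$\sup_{\nu\in K}\int_0^\infty (s-M)^+\,d\nu(s)<\infty\ \text{ for some } M\geq 0,\quad\text{or, equivalently, if}\quad \sup_{\nu\in K}\int_M^\infty s\,d\nu(s)<\infty\ \text{ for some } M\geq 0.$$ Additionally (that is, on top of being continuous and, when the preceding condition holds, convex), when (i) and (ii) hold the function $\psi$ can be chosen to be strictly increasing if and only if $$\sup_{\nu\in K}\nu((s,\infty))<\infty\quad\text{for all } s>0.$$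
   Context: $\mathbb R_+=[0,\infty)$, and $\mathcal M(\mathbb R_+)$ is the set of all (possibly nonfinite) measures $\mu\colon\mathcal B(\mathbb R_+)\to[0,\infty]$ on the Borel $\sigma$-algebra of $\mathbb R_+$. For a real number $a$, $a^+:=\max\{a,0\}$. *)

theory Defs
  imports "HOL-Analysis.Analysis"
begin

definition measures_Rplus :: "real measure set" where
  "measures_Rplus = {\<nu>. sets \<nu> = sets (restrict_space borel {0..})}"

text \<open>Suprema and integrals take values in \<^typ>\<open>ennreal\<close>, so that the supremum over the
  empty family is \<open>0\<close>.\<close>

definition tight_Rplus :: "real measure set \<Rightarrow> bool" where
  "tight_Rplus K \<longleftrightarrow> ((\<lambda>s::real. SUP \<nu>\<in>K. emeasure \<nu> {s<..}) \<longlongrightarrow> 0) at_top"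

text \<open>A function on the half-line is a function on \<^typ>\<open>real\<close> whose values at negative
  arguments are irrelevant: every \<open>\<nu> \<in> K\<close> has space \<open>{0..}\<close>.\<close>

definition test_function :: "real measure set \<Rightarrow> (real \<Rightarrow> real) \<Rightarrow> bool" where
  "test_function K \<psi> \<longleftrightarrow>
     \<psi> \<in> {0..} \<rightarrow> {0..} \<and> mono_on {0..} \<psi> \<and> \<psi> 0 = 0 \<and> filterlim \<psi> at_top at_top \<and>
     (SUP \<nu>\<in>K. \<integral>\<^sup>+s. ennreal (\<psi> s) \<partial>\<nu>) < \<infinity>"

end

theory Submission
  imports Defs
begin

text \<open>The test functions are constructed as series of elementary ones. Tightness yields points
  \<open>s\<^sub>n \<rightarrow> \<infinity>\<close> with \<open>\<nu> (s\<^sub>n, \<infinity>) \<le> 2\<^sup>-\<^sup>n\<close> for all \<open>\<nu> \<in> K\<close>, and the sum of the truncated ramps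
  \<open>min ((x - s\<^sub>n)\<^sup>+) 1\<close> is a continuous test function. Strictness is achieved by adding a
  series \<open>\<Sum>n. a\<^sub>n g ((x - 1/n)\<^sup>+)\<close> with rapidly decreasing \<open>a\<^sub>n > 0\<close>, where \<open>g\<close> is the
  bounded function \<open>t / (1 + t)\<close> in general and the identity in the convex case. The
  converse implications are Markov's inequality and the fact that a convex function
  vanishing at \<open>0\<close> dominates a linear one beyond any point where it is positive.\<close>

section \<open>Uniform bounds and series of real functions\<close>

text \<open>Every finiteness condition below is used in this form: one real bound common to the
  whole family, on which real arithmetic is available.\<close>

lemma SUP_ennreal_less_top_iff:
  fixes f :: "'a \<Rightarrow> ennreal"
  shows "(SUP x\<in>A. f x) < \<infinity> \<longleftrightarrow> (\<exists>C\<ge>0. \<forall>x\<in>A. f x \<le> ennreal C)"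
proof
  assume "(SUP x\<in>A. f x) < \<infinity>"
  then obtain C where "C \<ge> 0" "(SUP x\<in>A. f x) = ennreal C"
    by (cases "SUP x\<in>A. f x" rule: ennreal_cases) auto
  then show "\<exists>C\<ge>0. \<forall>x\<in>A. f x \<le> ennreal C"
    by (metis SUP_upper)
next
  assume "\<exists>C\<ge>0. \<forall>x\<in>A. f x \<le> ennreal C"
  then obtain C where "\<forall>x\<in>A. f x \<le> ennreal C" by blast
  then have "(SUP x\<in>A. f x) \<le> ennreal C" by (simp add: SUP_least)
  then show "(SUP x\<in>A. f x) < \<infinity>"
    using ennreal_less_top le_less_trans by (metis infinity_ennreal_def)
qed

lemma mono_on_suminf:
  fixes f :: "nat \<Rightarrow> real \<Rightarrow> real"
  assumes "\<And>n. mono_on A (f n)" and "\<And>x. x \<in> A \<Longrightarrow> summable (\<lambda>n. f n x)"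
  shows "mono_on A (\<lambda>x. \<Sum>n. f n x)"
  using assms by (intro mono_onI suminf_le) (auto dest: mono_onD)

text \<open>All increments are nonnegative, so one positive increment makes their sum positive. The
  index in \<open>sep\<close> may depend on the pair of points, which admits terms that are constant
  on part of \<open>A\<close>.\<close>

lemma strict_mono_on_suminf:
  fixes f :: "nat \<Rightarrow> real \<Rightarrow> real"
  assumes "\<And>n. mono_on A (f n)" and "\<And>x. x \<in> A \<Longrightarrow> summable (\<lambda>n. f n x)"
    and sep: "\<And>x y. x \<in> A \<Longrightarrow> y \<in> A \<Longrightarrow> x < y \<Longrightarrow> \<exists>n. f n x < f n y"
  shows "strict_mono_on A (\<lambda>x. \<Sum>n. f n x)"
proof (rule strict_mono_onI)
  fix x y assume xy: "x \<in> A" "y \<in> A" "x < y"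
  then obtain k where k: "f k x < f k y" using sep by blast
  have "0 < (\<Sum>n. f n y - f n x)"
  proof (rule suminf_pos2)
    show "summable (\<lambda>n. f n y - f n x)" using assms xy by (intro summable_diff)
    show "0 \<le> f n y - f n x" for n
      using assms(1)[of n] xy by (auto dest: mono_onD)
    show "0 < f k y - f k x" using k by simp
  qed
  also have "\<dots> = (\<Sum>n. f n y) - (\<Sum>n. f n x)"
    using assms(2) xy by (simp add: suminf_diff)
  finally show "(\<Sum>n. f n x) < (\<Sum>n. f n y)" by simp
qed

lemma convex_on_suminf:
  fixes f :: "nat \<Rightarrow> real \<Rightarrow> real"
  assumes "\<And>n. convex_on A (f n)" and sm: "\<And>x. x \<in> A \<Longrightarrow> summable (\<lambda>n. f n x)"
  shows "convex_on A (\<lambda>x. \<Sum>n. f n x)"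
proof -
  have A: "convex A" using assms(1) by (rule convex_on_imp_convex)
  show ?thesis
  proof (rule convex_onI[OF _ A])
    fix t x y :: real
    assume t: "0 < t" "t < 1" and xy: "x \<in> A" "y \<in> A"
    have z: "(1 - t) *\<^sub>R x + t *\<^sub>R y \<in> A"
      using convexD_alt[OF A xy, of t] t by simp
    have "(\<Sum>n. f n ((1 - t) *\<^sub>R x + t *\<^sub>R y)) \<le> (\<Sum>n. (1 - t) * f n x + t * f n y)"
      using assms z t xy
      by (intro suminf_le summable_add summable_mult convex_onD) auto
    also have "\<dots> = (1 - t) * (\<Sum>n. f n x) + t * (\<Sum>n. f n y)"
      using sm xy by (simp add: suminf_add[symmetric] suminf_mult summable_mult)
    finally show "(\<Sum>n. f n ((1 - t) *\<^sub>R x + t *\<^sub>R y))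
      \<le> (1 - t) * (\<Sum>n. f n x) + t * (\<Sum>n. f n y)" .
  qed
qed

lemma convex_on_positive_part:
  assumes "convex A"
  shows "convex_on A (\<lambda>x::real. max (x - M) 0)"
proof (rule convex_onI[OF _ assms])
  fix t x y :: real assume t: "0 < t" "t < 1"
  have "(1 - t) * max (x - M) 0 + t * max (y - M) 0 \<ge> (1 - t) * (x - M) + t * (y - M)"
    using t by (intro add_mono mult_left_mono) auto
  moreover have "(1 - t) * (x - M) + t * (y - M) = (1 - t) * x + t * y - M"
    by (simp add: algebra_simps)
  ultimately show "max ((1 - t) *\<^sub>R x + t *\<^sub>R y - M) 0
      \<le> (1 - t) * max (x - M) 0 + t * max (y - M) 0"
    using t by simp
qed

text \<open>Monotone terms vanishing at \<open>0\<close> are bounded on \<open>{0..R}\<close> by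
  their value at \<open>R\<close>. Summability at the single point \<open>R\<close> thus yields a
  Weierstrass majorant on the whole interval.\<close>

lemma continuous_on_suminf_mono:
  fixes f :: "nat \<Rightarrow> real \<Rightarrow> real"
  assumes mono: "\<And>n. mono_on {0..} (f n)" and zero: "\<And>n. f n 0 = 0"
    and cont: "\<And>n. continuous_on {0..} (f n)"
    and sm: "\<And>x. x \<ge> 0 \<Longrightarrow> summable (\<lambda>n. f n x)"
  shows "continuous_on {0..} (\<lambda>x. \<Sum>n. f n x)"
proof -
  have bounded: "continuous_on {0..R} (\<lambda>x. \<Sum>n. f n x)" if R: "R \<ge> 0" for R
  proof (rule uniform_limit_theorem)
    show "\<forall>\<^sub>F n in sequentially. continuous_on {0..R} (\<lambda>x. \<Sum>i<n. f i x)"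
      by (intro always_eventually allI continuous_on_sum continuous_on_subset[OF cont]) auto
    show "uniform_limit {0..R} (\<lambda>n x. \<Sum>i<n. f i x) (\<lambda>x. \<Sum>n. f n x) sequentially"
    proof (rule Weierstrass_m_test)
      fix n x assume x: "x \<in> {0..R}"
      then have "f n 0 \<le> f n x" "f n x \<le> f n R"
        using R by (auto intro!: mono_onD[OF mono])
      then show "norm (f n x) \<le> f n R" by (simp add: zero)
    qed (rule sm[OF R])
  qed simp
  show ?thesis
    unfolding continuous_on_eq_continuous_within
  proof
    fix x :: real assume x: "x \<in> {0..}"
    then have "continuous (at x within {0..x + 1}) (\<lambda>x. \<Sum>n. f n x)"
      using bounded[of "x + 1"] by (simp add: continuous_on_eq_continuous_within)
    \<comment> \<open>Continuity is local, and the interval contains a neighbourhood of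
      \<open>x\<close> relative to the half-line, also when \<open>x = 0\<close>.\<close>
    moreover have "at x within {0..x + 1} = at x within {0..}"
      by (rule at_within_nhd[of _ "{..<x + 1}"]) auto
    ultimately show "continuous (at x within {0..}) (\<lambda>x. \<Sum>n. f n x)" by simp
  qed
qed

section \<open>Integration against measures on the half-line\<close>

lemma measurable_measures_Rplus:
  fixes f :: "real \<Rightarrow> real"
  assumes "\<nu> \<in> measures_Rplus" and "continuous_on {0..} f"
  shows "f \<in> borel_measurable \<nu>"
proof -
  have "f \<in> borel_measurable (restrict_space borel {0..})"
    using assms(2) by (rule borel_measurable_continuous_on_restrict)
  moreover have "sets \<nu> = sets (restrict_space borel {0..})"
    using assms(1) by (simp add: measures_Rplus_def)
  ultimately show ?thesis by (simp cong: measurable_cong_sets)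
qed

lemma space_measures_Rplus:
  assumes "\<nu> \<in> measures_Rplus"
  shows "space \<nu> = {0..}"
  using assms sets_eq_imp_space_eq[of \<nu> "restrict_space borel {0..}"]
  by (simp add: measures_Rplus_def space_restrict_space)

lemma sets_measures_Rplus:
  assumes "\<nu> \<in> measures_Rplus" and "s \<ge> 0"
  shows "{s<..} \<in> sets \<nu>"
proof -
  have "{s<..} \<in> sets (restrict_space borel {0..})"
    using assms(2) by (subst sets_restrict_space_iff) auto
  then show ?thesis using assms(1) by (simp add: measures_Rplus_def)
qed

text \<open>Monotone convergence exchanges sum and integral. Both series constructions below get
  their uniform integral bound from here, because \<open>c\<close> can be chosen independently of
  the measure.\<close>

lemma nn_integral_suminf_le:
  fixes f :: "nat \<Rightarrow> real \<Rightarrow> real"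
  assumes \<nu>: "\<nu> \<in> measures_Rplus"
    and nonneg: "\<And>n x. x \<ge> 0 \<Longrightarrow> f n x \<ge> 0"
    and cont: "\<And>n. continuous_on {0..} (f n)"
    and sm: "\<And>x. x \<ge> 0 \<Longrightarrow> summable (\<lambda>n. f n x)"
    and le: "\<And>n. (\<integral>\<^sup>+x. ennreal (f n x) \<partial>\<nu>) \<le> ennreal (c n)"
    and c: "\<And>n. c n \<ge> 0" "summable c"
  shows "(\<integral>\<^sup>+x. ennreal (\<Sum>n. f n x) \<partial>\<nu>) \<le> ennreal (\<Sum>n. c n)"
proof -
  have "(\<integral>\<^sup>+x. ennreal (\<Sum>n. f n x) \<partial>\<nu>) = (\<integral>\<^sup>+x. (\<Sum>n. ennreal (f n x)) \<partial>\<nu>)"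
    by (rule nn_integral_cong) (simp add: space_measures_Rplus[OF \<nu>] suminf_ennreal2 nonneg sm)
  also have "\<dots> = (\<Sum>n. \<integral>\<^sup>+x. ennreal (f n x) \<partial>\<nu>)"
    using measurable_measures_Rplus[OF \<nu> cont] by (intro nn_integral_suminf) simp
  also have "\<dots> \<le> (\<Sum>n. ennreal (c n))"
    by (intro suminf_le le) auto
  also have "\<dots> = ennreal (\<Sum>n. c n)"
    using c by (simp add: suminf_ennreal2)
  finally show ?thesis .
qed

text \<open>Markov's inequality: by monotonicity the constant \<open>\<psi> s\<close> lies below
  \<open>\<psi>\<close> on the tail beyond \<open>s\<close>.\<close>

lemma emeasure_Markov_mono:
  assumes \<nu>: "\<nu> \<in> measures_Rplus" and "mono_on {0..} \<psi>" and "s \<ge> 0"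
  shows "ennreal (\<psi> s) * emeasure \<nu> {s<..} \<le> (\<integral>\<^sup>+x. ennreal (\<psi> x) \<partial>\<nu>)"
proof -
  have "ennreal (\<psi> s) * emeasure \<nu> {s<..} = (\<integral>\<^sup>+x. ennreal (\<psi> s) * indicator {s<..} x \<partial>\<nu>)"
    using sets_measures_Rplus[OF \<nu>] assms(3) by (simp add: nn_integral_cmult_indicator)
  also have "\<dots> \<le> (\<integral>\<^sup>+x. ennreal (\<psi> x) \<partial>\<nu>)"
    using assms(2,3)
    by (intro nn_integral_mono)
      (auto simp: indicator_def space_measures_Rplus[OF \<nu>] intro!: ennreal_leI elim!: mono_onD)
  finally show ?thesis .
qed

text \<open>Serves bounded integrands supported on a tail, with \<open>h = 0\<close>, and the
  comparison of two ramps, where \<open>h\<close> is the ramp already known to be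
  integrable.\<close>

lemma nn_integral_le_tail:
  fixes c s :: real
  assumes \<nu>: "\<nu> \<in> measures_Rplus" and "s \<ge> 0" and "c \<ge> 0" and "h \<in> borel_measurable \<nu>"
    and "\<And>x. x \<ge> 0 \<Longrightarrow> f x \<le> h x + ennreal c * indicator {s<..} x"
  shows "(\<integral>\<^sup>+x. f x \<partial>\<nu>) \<le> (\<integral>\<^sup>+x. h x \<partial>\<nu>) + ennreal c * emeasure \<nu> {s<..}"
proof -
  have [measurable]: "{s<..} \<in> sets \<nu>" using sets_measures_Rplus[OF \<nu>] assms(2) .
  have "(\<integral>\<^sup>+x. f x \<partial>\<nu>) \<le> (\<integral>\<^sup>+x. h x + ennreal c * indicator {s<..} x \<partial>\<nu>)"
    using assms(5) by (intro nn_integral_mono) (simp add: space_measures_Rplus[OF \<nu>])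
  also have "\<dots> = (\<integral>\<^sup>+x. h x \<partial>\<nu>) + ennreal c * emeasure \<nu> {s<..}"
    using assms(4) by (simp add: nn_integral_add nn_integral_cmult_indicator)
  finally show ?thesis .
qed

section \<open>Test functions and tightness\<close>

lemma test_functionE:
  assumes "test_function K \<psi>"
  obtains C where "\<And>x. x \<ge> 0 \<Longrightarrow> \<psi> x \<ge> 0" "mono_on {0..} \<psi>" "\<psi> 0 = 0"
    "filterlim \<psi> at_top at_top" "C \<ge> 0"
    "\<And>\<nu>. \<nu> \<in> K \<Longrightarrow> (\<integral>\<^sup>+x. ennreal (\<psi> x) \<partial>\<nu>) \<le> ennreal C"
  using assms unfolding test_function_def SUP_ennreal_less_top_iff by auto

lemma test_functionI:
  assumes mono: "mono_on {0..} \<psi>" and zero: "\<psi> 0 = 0" and "filterlim \<psi> at_top at_top"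
    and "C \<ge> 0" and "\<And>\<nu>. \<nu> \<in> K \<Longrightarrow> (\<integral>\<^sup>+x. ennreal (\<psi> x) \<partial>\<nu>) \<le> ennreal C"
  shows "test_function K \<psi>"
proof -
  have "\<psi> 0 \<le> \<psi> x" if "x \<ge> 0" for x
    using mono_onD[OF mono, of 0 x] that by simp
  then show ?thesis
    using assms unfolding test_function_def SUP_ennreal_less_top_iff by auto
qed

text \<open>Markov's inequality bounds the tails by \<open>C / \<psi> s\<close> uniformly over
  \<open>K\<close>, and this bound tends to \<open>0\<close> because \<open>\<psi>\<close> tends to
  infinity.\<close>

lemma test_function_imp_tight:
  assumes K: "K \<subseteq> measures_Rplus" and "test_function K \<psi>"
  shows "tight_Rplus K"
proof -
  from assms(2) obtain C where \<psi>: "\<And>x. x \<ge> 0 \<Longrightarrow> \<psi> x \<ge> 0" "mono_on {0..} \<psi>" "\<psi> 0 = 0"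
      "filterlim \<psi> at_top at_top" "C \<ge> 0"
      "\<And>\<nu>. \<nu> \<in> K \<Longrightarrow> (\<integral>\<^sup>+x. ennreal (\<psi> x) \<partial>\<nu>) \<le> ennreal C"
    by (rule test_functionE) blast
  have lim: "((\<lambda>s. ennreal (C / \<psi> s)) \<longlongrightarrow> 0) at_top"
    using tendsto_ennrealI[OF tendsto_divide_0[OF tendsto_const[of C]
        filterlim_at_top_imp_at_infinity[OF \<psi>(4)]]] by simp
  have "\<forall>\<^sub>F s in at_top. (SUP \<nu>\<in>K. emeasure \<nu> {s<..}) \<le> ennreal (C / \<psi> s)"
    using eventually_ge_at_top[of "0::real"] \<psi>(4)[unfolded filterlim_at_top_dense, rule_format, of 0]
  proof eventually_elim
    case (elim s)
    show ?case
    proof (rule SUP_least)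
      fix \<nu> assume \<nu>: "\<nu> \<in> K"
      have "ennreal (\<psi> s) * emeasure \<nu> {s<..} \<le> ennreal C"
        using emeasure_Markov_mono[of \<nu> \<psi> s] \<psi>(2) \<psi>(6)[OF \<nu>] elim K \<nu>
        by (auto intro: order_trans)
      \<comment> \<open>The tail could a priori be infinite, so \<open>\<psi> s\<close> is cancelled
        inside \<open>ennreal\<close> by its finite inverse.\<close>
      then have "ennreal (inverse (\<psi> s)) * (ennreal (\<psi> s) * emeasure \<nu> {s<..})
          \<le> ennreal (inverse (\<psi> s)) * ennreal C"
        by (rule mult_left_mono) simp
      then show "emeasure \<nu> {s<..} \<le> ennreal (C / \<psi> s)"
        using elim \<psi>(5)
        by (simp add: mult.assoc[symmetric] ennreal_mult[symmetric] divide_inverse mult.commute)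
    qed
  qed
  then show ?thesis unfolding tight_Rplus_def
    by (intro tendsto_sandwich[OF _ _ tendsto_const lim]) auto
qed

lemma tight_imp_continuous_test_function:
  assumes K: "K \<subseteq> measures_Rplus" and tight: "tight_Rplus K"
  shows "\<exists>\<psi>. test_function K \<psi> \<and> continuous_on {0..} \<psi>"
proof -
  \<comment> \<open>The tail bounds make the integrals summable; the bound
    \<open>s \<ge> real n\<close> makes the series of ramps locally finite.\<close>
  have "\<exists>s. s \<ge> real n \<and> (SUP \<nu>\<in>K. emeasure \<nu> {s<..}) < ennreal ((1/2)^n)" for n
  proof -
    have "\<forall>\<^sub>F s in at_top. (SUP \<nu>\<in>K. emeasure \<nu> {s<..}) < ennreal ((1/2)^n)"
      using tight unfolding tight_Rplus_def by (rule order_tendstoD) simp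
    then have "\<forall>\<^sub>F s in at_top. s \<ge> real n \<and> (SUP \<nu>\<in>K. emeasure \<nu> {s<..}) < ennreal ((1/2)^n)"
      by (intro eventually_conj eventually_ge_at_top)
    then show ?thesis by (intro eventually_happens') simp_all
  qed
  then have "\<exists>s. \<forall>n. s n \<ge> real n \<and> (SUP \<nu>\<in>K. emeasure \<nu> {s n<..}) < ennreal ((1/2)^n)"
    by (intro choice allI)
  then obtain s where s: "\<And>n. s n \<ge> real n"
      "\<And>n. (SUP \<nu>\<in>K. emeasure \<nu> {s n<..}) < ennreal ((1/2)^n)"
    by blast
  define f where "f n x = min (max (x - s n) 0) 1" for n x
  define \<psi> where "\<psi> x = (\<Sum>n. f n x)" for x
  have s0: "s n \<ge> 0" for n using s(1)[of n] by linarith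
  have mono: "mono_on {0..} (f n)" for n by (rule mono_onI) (auto simp: f_def)
  have zero: "f n 0 = 0" for n using s0[of n] by (simp add: f_def)
  have nonneg: "f n x \<ge> 0" for n x by (simp add: f_def)
  have cont: "continuous_on {0..} (f n)" for n unfolding f_def by (intro continuous_intros)
  \<comment> \<open>Only indices with \<open>s n < x\<close> contribute at \<open>x\<close>, and
    these satisfy \<open>n < x\<close>.\<close>
  have sm: "summable (\<lambda>n. f n x)" for x
  proof (rule summable_finite)
    show "finite {..nat \<lceil>x\<rceil>}" by simp
    fix n assume "n \<notin> {..nat \<lceil>x\<rceil>}"
    then have "x \<le> real n" by (simp add: not_le) linarith
    then show "f n x = 0" using s(1)[of n] by (simp add: f_def)
  qed
  have "(\<integral>\<^sup>+x. ennreal (\<psi> x) \<partial>\<nu>) \<le> ennreal (\<Sum>n. (1/2)^n)" if "\<nu> \<in> K" for \<nu>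
    unfolding \<psi>_def
  proof (rule nn_integral_suminf_le)
    show \<nu>: "\<nu> \<in> measures_Rplus" using that K by blast
    fix n
    \<comment> \<open>The truncated ramp is at most \<open>1\<close> and vanishes up to
      \<open>s n\<close>, hence lies below the indicator of the tail.\<close>
    have "(\<integral>\<^sup>+x. ennreal (f n x) \<partial>\<nu>) \<le> (\<integral>\<^sup>+x. 0 \<partial>\<nu>) + ennreal 1 * emeasure \<nu> {s n<..}"
      by (rule nn_integral_le_tail[OF \<nu> s0]) (auto simp: f_def indicator_def)
    also have "\<dots> \<le> ennreal ((1/2)^n)"
      using s(2)[of n] SUP_upper[OF that, of "\<lambda>\<nu>. emeasure \<nu> {s n<..}"] by simp
    finally show "(\<integral>\<^sup>+x. ennreal (f n x) \<partial>\<nu>) \<le> ennreal ((1/2)^n)" .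
  qed (use nonneg cont sm in \<open>auto intro: summable_geometric\<close>)
  moreover have "filterlim \<psi> at_top at_top"
    unfolding filterlim_at_top
  proof
    fix Z :: real
    \<comment> \<open>Once \<open>x\<close> has passed \<open>s n + 1\<close> for the first
      \<open>N\<close> indices, each of these ramps has saturated at \<open>1\<close> and their sum
      is \<open>N\<close>.\<close>
    define N where "N = nat \<lceil>Z\<rceil>"
    have "\<forall>\<^sub>F x in at_top. \<forall>n\<in>{..<N}. s n + 1 \<le> x"
      by (intro eventually_ball_finite ballI eventually_ge_at_top) simp
    then show "\<forall>\<^sub>F x in at_top. Z \<le> \<psi> x"
    proof eventually_elim
      case (elim x)
      have one: "f n x = 1" if "n \<in> {..<N}" for n
      proof -
        have "s n + 1 \<le> x" using elim that by blast
        then show ?thesis by (simp add: f_def)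
      qed
      have "Z \<le> real N" unfolding N_def by linarith
      also have "\<dots> = (\<Sum>n<N. f n x)" by (simp add: one)
      also have "\<dots> \<le> \<psi> x"
        unfolding \<psi>_def by (intro sum_le_suminf sm nonneg) auto
      finally show ?case .
    qed
  qed
  moreover have "(\<Sum>n. (1/2::real)^n) \<ge> 0" by (intro suminf_nonneg summable_geometric) auto
  ultimately have "test_function K \<psi>"
    using mono_on_suminf[OF mono sm] zero
    by (intro test_functionI[where C = "\<Sum>n. (1/2)^n"]) (auto simp: \<psi>_def[abs_def])
  moreover have "continuous_on {0..} \<psi>"
    unfolding \<psi>_def[abs_def] by (rule continuous_on_suminf_mono[OF mono zero cont sm])
  ultimately show ?thesis by blast
qed

section \<open>Strictly increasing test functions\<close>

text \<open>Adds to \<open>\<psi>\<close> a weighted series of shifted copies of \<open>g\<close>.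
  Each copy vanishes near \<open>0\<close>, where the measures may have infinite mass, while the
  shifts tend to \<open>0\<close>, so together the copies separate all points.\<close>

lemma add_strict_mono_test_function:
  fixes g :: "real \<Rightarrow> real"
  assumes K: "K \<subseteq> measures_Rplus"
    and \<psi>: "test_function K \<psi>" "continuous_on {0..} \<psi>"
    and g: "strict_mono_on {0..} g" "continuous_on {0..} g" "g 0 = 0" "\<And>t. t \<ge> 0 \<Longrightarrow> g t \<le> t"
    and bound: "\<And>s. s > 0 \<Longrightarrow> \<exists>C\<ge>0. \<forall>\<nu>\<in>K. (\<integral>\<^sup>+x. ennreal (g (max (x - s) 0)) \<partial>\<nu>) \<le> ennreal C"
  obtains \<phi> where "test_function K \<phi>" "continuous_on {0..} \<phi>" "strict_mono_on {0..} \<phi>"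
    "convex_on {0..} \<psi> \<Longrightarrow> convex_on {0..} g \<Longrightarrow> convex_on {0..} \<phi>"
proof -
  define h where "h n x = g (max (x - 1 / Suc n) 0)" for n :: nat and x
  have "\<exists>C\<ge>0. \<forall>\<nu>\<in>K. (\<integral>\<^sup>+x. ennreal (h n x) \<partial>\<nu>) \<le> ennreal C" for n
    unfolding h_def by (rule bound) simp
  then obtain C where C: "\<And>n. C n \<ge> 0"
      "\<And>n \<nu>. \<nu> \<in> K \<Longrightarrow> (\<integral>\<^sup>+x. ennreal (h n x) \<partial>\<nu>) \<le> ennreal (C n)"
    by metis
  \<comment> \<open>The weight meets two demands at once: \<open>a n \<le> (1/2)^n\<close> gives
    pointwise convergence and \<open>a n * C n \<le> (1/2)^n\<close> controls the integrals. The
    summand \<open>1\<close> yields the first and keeps the denominator positive.\<close>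
  define a where "a n = (1/2)^n / (1 + C n)" for n
  have a: "a n > 0" "a n \<le> (1/2)^n" "a n * C n \<le> (1/2)^n" for n
  proof -
    have "q / (1 + c) > 0 \<and> q / (1 + c) \<le> q \<and> q / (1 + c) * c \<le> q" if "q > 0" "c \<ge> 0" for q c :: real
      using that by (auto simp: field_simps)
    from this[of "(1/2)^n" "C n"] show "a n > 0" "a n \<le> (1/2)^n" "a n * C n \<le> (1/2)^n"
      using C(1)[of n] by (simp_all add: a_def)
  qed
  define f where "f n x = a n * h n x" for n x
  have g_mono: "mono_on {0..} g" using g(1) by (rule strict_mono_on_imp_mono_on)
  have g_nonneg: "g t \<ge> 0" if "t \<ge> 0" for t
    using mono_onD[OF g_mono, of 0 t] that g(3) by simp
  have h_nonneg: "h n x \<ge> 0" for n x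
    using g_nonneg by (simp add: h_def)
  have nonneg: "f n x \<ge> 0" for n x
    using a(1)[of n] h_nonneg by (simp add: f_def)
  have mono: "mono_on {0..} (f n)" for n
    using a(1)[of n] by (intro mono_onI) (auto simp: f_def h_def intro!: mono_onD[OF g_mono])
  have zero: "f n 0 = 0" for n by (simp add: f_def h_def g(3))
  have cont: "continuous_on {0..} (f n)" for n
    unfolding f_def h_def
    by (intro continuous_intros continuous_on_compose2[OF g(2)]) auto
  have sm: "summable (\<lambda>n. f n x)" if "x \<ge> 0" for x
  proof (rule summable_comparison_test'[of "\<lambda>n. x * (1/2)^n" 0])
    show "summable (\<lambda>n. x * (1/2)^n)" by (intro summable_mult summable_geometric) simp
    fix n :: nat
    \<comment> \<open>Linear growth of \<open>g\<close> bounds all \<open>h n x\<close> by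
      \<open>x\<close>, independently of \<open>n\<close>, so the weights alone ensure
      convergence.\<close>
    have "h n x \<le> max (x - 1 / Suc n) 0" unfolding h_def by (rule g(4)) simp
    also have "\<dots> \<le> x" using that by simp
    finally have "a n * h n x \<le> (1/2)^n * x"
      using a(1,2)[of n] h_nonneg by (intro mult_mono) auto
    then show "norm (f n x) \<le> x * (1/2)^n"
      using nonneg[of n x] by (simp add: f_def mult.commute)
  qed
  define \<phi> where "\<phi> x = (\<Sum>n. f n x)" for x
  have \<phi>_int: "(\<integral>\<^sup>+x. ennreal (\<phi> x) \<partial>\<nu>) \<le> ennreal (\<Sum>n. (1/2)^n)" if "\<nu> \<in> K" for \<nu>
    unfolding \<phi>_def
  proof (rule nn_integral_suminf_le)
    show \<nu>: "\<nu> \<in> measures_Rplus" using that K by blast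
    fix n
    have "h n = (\<lambda>x. inverse (a n) * f n x)" using a(1)[of n] by (auto simp: f_def)
    then have meas: "h n \<in> borel_measurable \<nu>"
      using measurable_measures_Rplus[OF \<nu> cont[of n]] by simp
    have "(\<integral>\<^sup>+x. ennreal (f n x) \<partial>\<nu>) = ennreal (a n) * (\<integral>\<^sup>+x. ennreal (h n x) \<partial>\<nu>)"
      using meas a(1)[of n] h_nonneg by (simp add: f_def ennreal_mult nn_integral_cmult)
    also have "\<dots> \<le> ennreal (a n) * ennreal (C n)" by (intro mult_left_mono C that) simp
    also have "\<dots> \<le> ennreal ((1/2)^n)"
      using a[of n] C(1)[of n] by (simp add: ennreal_mult[symmetric] ennreal_leI)
    finally show "(\<integral>\<^sup>+x. ennreal (f n x) \<partial>\<nu>) \<le> ennreal ((1/2)^n)" .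
  qed (use nonneg cont sm in \<open>auto intro: summable_geometric\<close>)
  have \<phi>_mono: "mono_on {0..} \<phi>"
    unfolding \<phi>_def[abs_def] using mono sm by (intro mono_on_suminf) auto
  have \<phi>_cont: "continuous_on {0..} \<phi>"
    unfolding \<phi>_def[abs_def] by (rule continuous_on_suminf_mono[OF mono zero cont sm])
  have \<phi>_strict: "strict_mono_on {0..} \<phi>"
    unfolding \<phi>_def[abs_def]
  proof (rule strict_mono_on_suminf[OF mono])
    fix x y :: real assume xy: "x \<in> {0..}" "y \<in> {0..}" "x < y"
    \<comment> \<open>For such \<open>n\<close> the shifted argument is positive at \<open>y\<close>
      and strictly smaller at \<open>x\<close>, even if it is cut off to \<open>0\<close>
      there.\<close>
    then obtain n where n: "1 / Suc n < y" using reals_Archimedean[of y]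
      by (auto simp: inverse_eq_divide)
    have "h n x < h n y"
      unfolding h_def using n xy by (intro strict_mono_onD[OF g(1)]) auto
    then have "f n x < f n y" using a(1)[of n] by (simp add: f_def)
    then show "\<exists>n. f n x < f n y" ..
  qed (use sm in auto)
  have \<phi>_zero: "\<phi> 0 = 0" by (simp add: \<phi>_def zero)
  have \<phi>_nonneg: "\<phi> x \<ge> 0" if "x \<ge> 0" for x
    using mono_onD[OF \<phi>_mono, of 0 x] that \<phi>_zero by simp
  from \<psi>(1) obtain D where \<psi>': "\<And>x. x \<ge> 0 \<Longrightarrow> \<psi> x \<ge> 0" "mono_on {0..} \<psi>" "\<psi> 0 = 0"
      "filterlim \<psi> at_top at_top" "D \<ge> 0"
      "\<And>\<nu>. \<nu> \<in> K \<Longrightarrow> (\<integral>\<^sup>+x. ennreal (\<psi> x) \<partial>\<nu>) \<le> ennreal D"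
    by (rule test_functionE) blast
  have E: "(\<Sum>n. (1/2::real)^n) \<ge> 0" by (intro suminf_nonneg summable_geometric) auto
  have "test_function K (\<lambda>x. \<psi> x + \<phi> x)"
  proof (rule test_functionI)
    show "mono_on {0..} (\<lambda>x. \<psi> x + \<phi> x)"
      by (intro mono_onI add_mono mono_onD[OF \<psi>'(2)] mono_onD[OF \<phi>_mono])
    show "\<psi> 0 + \<phi> 0 = 0" using \<psi>'(3) \<phi>_zero by simp
    show "filterlim (\<lambda>x. \<psi> x + \<phi> x) at_top at_top"
    proof (rule filterlim_at_top_mono[OF \<psi>'(4)])
      show "\<forall>\<^sub>F x in at_top. \<psi> x \<le> \<psi> x + \<phi> x"
        using eventually_ge_at_top[of 0] by eventually_elim (simp add: \<phi>_nonneg)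
    qed
    show "D + (\<Sum>n. (1/2)^n) \<ge> 0" using \<psi>'(5) E by simp
    fix \<nu> assume \<nu>: "\<nu> \<in> K"
    then have \<nu>': "\<nu> \<in> measures_Rplus" using K by blast
    have "(\<integral>\<^sup>+x. ennreal (\<psi> x + \<phi> x) \<partial>\<nu>) = (\<integral>\<^sup>+x. ennreal (\<psi> x) + ennreal (\<phi> x) \<partial>\<nu>)"
      by (rule nn_integral_cong) (simp add: space_measures_Rplus[OF \<nu>'] \<psi>'(1) \<phi>_nonneg)
    also have "\<dots> = (\<integral>\<^sup>+x. ennreal (\<psi> x) \<partial>\<nu>) + (\<integral>\<^sup>+x. ennreal (\<phi> x) \<partial>\<nu>)"
      using measurable_measures_Rplus[OF \<nu>'] \<psi>(2) \<phi>_cont by (intro nn_integral_add) auto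
    also have "\<dots> \<le> ennreal D + ennreal (\<Sum>n. (1/2)^n)"
      by (intro add_mono \<psi>'(6) \<phi>_int \<nu>)
    finally show "(\<integral>\<^sup>+x. ennreal (\<psi> x + \<phi> x) \<partial>\<nu>) \<le> ennreal (D + (\<Sum>n. (1/2)^n))"
      using \<psi>'(5) E by (simp add: ennreal_plus)
  qed
  moreover have "continuous_on {0..} (\<lambda>x. \<psi> x + \<phi> x)"
    using \<psi>(2) \<phi>_cont by (rule continuous_on_add)
  moreover have "strict_mono_on {0..} (\<lambda>x. \<psi> x + \<phi> x)"
    by (intro strict_mono_onI add_le_less_mono mono_onD[OF \<psi>'(2)] strict_mono_onD[OF \<phi>_strict])
      auto
  moreover have "convex_on {0..} (\<lambda>x. \<psi> x + \<phi> x)" if "convex_on {0..} \<psi>" and cg: "convex_on {0..} g"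
  proof (rule convex_on_add)
    show "convex_on {0..} \<phi>"
      unfolding \<phi>_def[abs_def]
    proof (rule convex_on_suminf)
      fix n
      \<comment> \<open>A nondecreasing convex function composed with the convex ramp
        \<open>p\<close> is convex.\<close>
      have "convex_on {0..} (h n)"
      proof (rule convex_onI)
        fix t x y :: real assume t: "0 < t" "t < 1" and "x \<in> {0..}" "y \<in> {0..}"
        define p where "p z = max (z - 1 / Suc n) 0" for z
        have "p ((1 - t) * x + t * y) \<le> (1 - t) * p x + t * p y"
          using convex_onD[OF convex_on_positive_part[of UNIV "1 / Suc n"], of t x y] t
          by (simp add: p_def)
        then have "g (p ((1 - t) * x + t * y)) \<le> g ((1 - t) * p x + t * p y)"
          using t by (intro mono_onD[OF g_mono]) (auto simp: p_def)
        also have "\<dots> \<le> (1 - t) * g (p x) + t * g (p y)"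
          using convex_onD[OF cg, of t "p x" "p y"] t by (simp add: p_def)
        finally show "h n ((1 - t) *\<^sub>R x + t *\<^sub>R y) \<le> (1 - t) * h n x + t * h n y"
          by (simp add: h_def p_def)
      qed simp
      then show "convex_on {0..} (f n)"
        unfolding f_def[abs_def] using a(1)[of n] by (intro convex_on_cmul) auto
    qed (use sm in auto)
  qed fact
  ultimately show thesis by (rule that)
qed

text \<open>Strictness and \<open>\<psi> 0 = 0\<close> make \<open>\<psi>\<close> positive at every
  \<open>s > 0\<close>, so Markov's inequality gives a finite bound there and not only for large
  \<open>s\<close>.\<close>

lemma strict_test_function_imp_finite_tails:
  assumes K: "K \<subseteq> measures_Rplus" and "test_function K \<psi>" and strict: "strict_mono_on {0..} \<psi>"
    and s: "s > 0"
  shows "(SUP \<nu>\<in>K. emeasure \<nu> {s<..}) < \<infinity>"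
proof -
  from assms(2) obtain C where \<psi>: "\<And>x. x \<ge> 0 \<Longrightarrow> \<psi> x \<ge> 0" "mono_on {0..} \<psi>" "\<psi> 0 = 0"
      "filterlim \<psi> at_top at_top" "C \<ge> 0"
      "\<And>\<nu>. \<nu> \<in> K \<Longrightarrow> (\<integral>\<^sup>+x. ennreal (\<psi> x) \<partial>\<nu>) \<le> ennreal C"
    by (rule test_functionE) blast
  have pos: "\<psi> s > 0" using strict_mono_onD[OF strict, of 0 s] s \<psi>(3) by simp
  have "emeasure \<nu> {s<..} \<le> ennreal (C / \<psi> s)" if \<nu>: "\<nu> \<in> K" for \<nu>
  proof -
    have "ennreal (\<psi> s) * emeasure \<nu> {s<..} \<le> ennreal C"
      using emeasure_Markov_mono[of \<nu> \<psi> s] \<psi>(2) \<psi>(6)[OF \<nu>] s K \<nu>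
      by (auto intro: order_trans)
    then have "ennreal (inverse (\<psi> s)) * (ennreal (\<psi> s) * emeasure \<nu> {s<..})
        \<le> ennreal (inverse (\<psi> s)) * ennreal C"
      by (rule mult_left_mono) simp
    then show ?thesis
      using pos \<psi>(5)
      by (simp add: mult.assoc[symmetric] ennreal_mult[symmetric] divide_inverse mult.commute)
  qed
  moreover have "C / \<psi> s \<ge> 0" using pos \<psi>(5) by simp
  ultimately show ?thesis unfolding SUP_ennreal_less_top_iff by blast
qed

section \<open>Convex test functions and truncated first moments\<close>

text \<open>The truncated moment condition is precisely the integral bound for the ramp, which is
  itself the convex test function sought.\<close>

lemma truncated_identity_test_function:
  assumes "M \<ge> 0" and "(SUP \<nu>\<in>K. \<integral>\<^sup>+s. ennreal (max (s - M) 0) \<partial>\<nu>) < \<infinity>"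
  shows "test_function K (\<lambda>s. max (s - M) 0)" "continuous_on {0..} (\<lambda>s. max (s - M) 0)"
    "convex_on {0..} (\<lambda>s. max (s - M) 0)"
proof -
  have "filterlim (\<lambda>s. s - M) at_top at_top"
    using filterlim_tendsto_add_at_top[OF tendsto_const[of "- M"] filterlim_ident] by simp
  then have "filterlim (\<lambda>s. max (s - M) 0) at_top at_top"
    by (rule filterlim_at_top_mono) simp
  then show "test_function K (\<lambda>s. max (s - M) 0)"
    using assms unfolding test_function_def by (auto intro!: mono_onI)
  show "continuous_on {0..} (\<lambda>s. max (s - M) 0)" by (intro continuous_intros)
  show "convex_on {0..} (\<lambda>s. max (s - M) 0)" by (rule convex_on_positive_part) simp
qed

lemma convex_test_function_imp_first_moment:
  assumes K: "K \<subseteq> measures_Rplus" and "test_function K \<psi>" and conv: "convex_on {0..} \<psi>"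
  shows "\<exists>M\<ge>0. (SUP \<nu>\<in>K. \<integral>\<^sup>+s\<in>{M..}. ennreal s \<partial>\<nu>) < \<infinity>"
proof -
  from assms(2) obtain C where \<psi>: "\<And>x. x \<ge> 0 \<Longrightarrow> \<psi> x \<ge> 0" "mono_on {0..} \<psi>" "\<psi> 0 = 0"
      "filterlim \<psi> at_top at_top" "C \<ge> 0"
      "\<And>\<nu>. \<nu> \<in> K \<Longrightarrow> (\<integral>\<^sup>+x. ennreal (\<psi> x) \<partial>\<nu>) \<le> ennreal C"
    by (rule test_functionE) blast
  have "\<forall>\<^sub>F M in at_top. M > 0 \<and> \<psi> M > 0"
    using \<psi>(4) by (intro eventually_conj eventually_gt_at_top) (simp add: filterlim_at_top_dense)
  then have "\<exists>M. M > 0 \<and> \<psi> M > 0" by (intro eventually_happens') simp_all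
  then obtain M where M: "M > 0" "\<psi> M > 0" by blast
  \<comment> \<open>The point \<open>M\<close> is the convex combination of \<open>0\<close> and
    \<open>x\<close> with weight \<open>M / x\<close> on \<open>x\<close>; since
    \<open>\<psi> 0 = 0\<close>, the chord gives the linear lower bound.\<close>
  have linear: "\<psi> M / M * x \<le> \<psi> x" if x: "x \<ge> M" for x
  proof -
    have "\<psi> ((1 - M / x) *\<^sub>R 0 + (M / x) *\<^sub>R x) \<le> (1 - M / x) * \<psi> 0 + M / x * \<psi> x"
      using x M by (intro convex_onD[OF conv]) auto
    then show ?thesis using x M \<psi>(3) by (simp add: field_simps)
  qed
  have "(\<integral>\<^sup>+s\<in>{M..}. ennreal s \<partial>\<nu>) \<le> ennreal (M / \<psi> M * C)" if \<nu>: "\<nu> \<in> K" for \<nu>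
  proof -
    \<comment> \<open>The slope of the linear minorant: \<open>k * s \<le> \<psi> s\<close> on
      \<open>{M..}\<close>, so the truncated moment is at most \<open>C / k\<close>.\<close>
    define k where "k = \<psi> M / M"
    have k: "k > 0" using M by (simp add: k_def)
    have \<nu>': "\<nu> \<in> measures_Rplus" using \<nu> K by blast
    have "{M..} \<in> sets (restrict_space borel {0..})"
      using M by (subst sets_restrict_space_iff) auto
    then have [measurable]: "{M..} \<in> sets \<nu>" using \<nu>' by (simp add: measures_Rplus_def)
    have [measurable]: "(\<lambda>s. s) \<in> borel_measurable \<nu>"
      using measurable_measures_Rplus[OF \<nu>' continuous_on_id] .
    have meas: "(\<lambda>s. ennreal s * indicator {M..} s) \<in> borel_measurable \<nu>"
      by measurable
    have "ennreal k * (\<integral>\<^sup>+s\<in>{M..}. ennreal s \<partial>\<nu>) = (\<integral>\<^sup>+s. ennreal k * (ennreal s * indicator {M..} s) \<partial>\<nu>)"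
      using meas by (simp add: nn_integral_cmult)
    also have "\<dots> \<le> (\<integral>\<^sup>+s. ennreal (\<psi> s) \<partial>\<nu>)"
      using linear k M
      by (intro nn_integral_mono)
        (auto simp: indicator_def k_def[symmetric] ennreal_mult[symmetric] intro!: ennreal_leI)
    also have "\<dots> \<le> ennreal C" by (rule \<psi>(6)[OF \<nu>])
    finally have "ennreal (inverse k) * (ennreal k * (\<integral>\<^sup>+s\<in>{M..}. ennreal s \<partial>\<nu>))
        \<le> ennreal (inverse k) * ennreal C"
      by (rule mult_left_mono) simp
    then have "(\<integral>\<^sup>+s\<in>{M..}. ennreal s \<partial>\<nu>) \<le> ennreal (inverse k * C)"
      using k \<psi>(5) by (simp add: mult.assoc[symmetric] ennreal_mult[symmetric])
    then show ?thesis by (simp add: k_def)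
  qed
  moreover have "M / \<psi> M * C \<ge> 0" using M \<psi>(5) by simp
  ultimately show ?thesis unfolding SUP_ennreal_less_top_iff using M by (intro exI[of _ M]) auto
qed

text \<open>The ramp lies below the truncated identity for the same \<open>M\<close>. The converse
  can force a larger \<open>M\<close>, since the ramp does not see mass at \<open>M\<close>; it is
  obtained through convex test functions.\<close>

lemma first_moment_imp_truncated:
  assumes "M \<ge> 0" and "(SUP \<nu>\<in>K. \<integral>\<^sup>+s\<in>{M..}. ennreal s \<partial>\<nu>) < \<infinity>"
  shows "(SUP \<nu>\<in>K. \<integral>\<^sup>+s. ennreal (max (s - M) 0) \<partial>\<nu>) < \<infinity>"
proof (rule le_less_trans[OF _ assms(2)])
  show "(SUP \<nu>\<in>K. \<integral>\<^sup>+s. ennreal (max (s - M) 0) \<partial>\<nu>) \<le> (SUP \<nu>\<in>K. \<integral>\<^sup>+s\<in>{M..}. ennreal s \<partial>\<nu>)"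
    using assms(1)
    by (intro SUP_mono' nn_integral_mono) (auto simp: indicator_def intro!: ennreal_leI)
qed

section \<open>Assembly of the equivalences\<close>

text \<open>Convexity and strictness are each characterised with and without continuity: the weakest
  choice of \<open>\<psi>\<close> must force the condition, and the condition must provide the
  strongest choice.\<close>

theorem lemma2p1:
  fixes K :: "real measure set"
  assumes "K \<subseteq> measures_Rplus"
  shows "(tight_Rplus K \<longleftrightarrow> (\<exists>\<psi>. test_function K \<psi>)) \<and>
    ((\<exists>\<psi>. test_function K \<psi>) \<longrightarrow> (\<exists>\<psi>. test_function K \<psi> \<and> continuous_on {0..} \<psi>)) \<and>
    ((\<exists>\<psi>. test_function K \<psi> \<and> convex_on {0..} \<psi>) \<longleftrightarrow>
      (\<exists>M\<ge>0. (SUP \<nu>\<in>K. \<integral>\<^sup>+s. ennreal (max (s - M) 0) \<partial>\<nu>) < \<infinity>)) \<and>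
    ((\<exists>\<psi>. test_function K \<psi> \<and> continuous_on {0..} \<psi> \<and> convex_on {0..} \<psi>) \<longleftrightarrow>
      (\<exists>M\<ge>0. (SUP \<nu>\<in>K. \<integral>\<^sup>+s. ennreal (max (s - M) 0) \<partial>\<nu>) < \<infinity>)) \<and>
    ((\<exists>M\<ge>0. (SUP \<nu>\<in>K. \<integral>\<^sup>+s. ennreal (max (s - M) 0) \<partial>\<nu>) < \<infinity>) \<longleftrightarrow>
      (\<exists>M\<ge>0. (SUP \<nu>\<in>K. \<integral>\<^sup>+s\<in>{M..}. ennreal s \<partial>\<nu>) < \<infinity>)) \<and>
    (tight_Rplus K \<and> (\<exists>\<psi>. test_function K \<psi>) \<longrightarrow>
      ((\<exists>\<psi>. test_function K \<psi> \<and> strict_mono_on {0..} \<psi>) \<longleftrightarrow>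
        (\<forall>s>0. (SUP \<nu>\<in>K. emeasure \<nu> {s<..}) < \<infinity>)) \<and>
      ((\<exists>\<psi>. test_function K \<psi> \<and> continuous_on {0..} \<psi> \<and> strict_mono_on {0..} \<psi>) \<longleftrightarrow>
        (\<forall>s>0. (SUP \<nu>\<in>K. emeasure \<nu> {s<..}) < \<infinity>)) \<and>
      ((\<exists>M\<ge>0. (SUP \<nu>\<in>K. \<integral>\<^sup>+s. ennreal (max (s - M) 0) \<partial>\<nu>) < \<infinity>) \<longrightarrow>
        ((\<exists>\<psi>. test_function K \<psi> \<and> continuous_on {0..} \<psi> \<and> convex_on {0..} \<psi> \<and>
            strict_mono_on {0..} \<psi>) \<longleftrightarrow>
          (\<forall>s>0. (SUP \<nu>\<in>K. emeasure \<nu> {s<..}) < \<infinity>))))"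
proof -
  define moment where "moment \<longleftrightarrow> (\<exists>M\<ge>0. (SUP \<nu>\<in>K. \<integral>\<^sup>+s. ennreal (max (s - M) 0) \<partial>\<nu>) < \<infinity>)"
  define tails where "tails \<longleftrightarrow> (\<forall>s>0. (SUP \<nu>\<in>K. emeasure \<nu> {s<..}) < \<infinity>)"
  note K = assms
  have tight: "tight_Rplus K" if "test_function K \<psi>" for \<psi>
    using test_function_imp_tight[OF K that] .
  have cont: "\<exists>\<psi>. test_function K \<psi> \<and> continuous_on {0..} \<psi>" if "tight_Rplus K"
    using tight_imp_continuous_test_function[OF K that] .
  have convex_moment: "\<exists>M\<ge>0. (SUP \<nu>\<in>K. \<integral>\<^sup>+s\<in>{M..}. ennreal s \<partial>\<nu>) < \<infinity>"
    if "test_function K \<psi>" "convex_on {0..} \<psi>" for \<psi>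
    using convex_test_function_imp_first_moment[OF K that] .
  have moment_convex: "\<exists>\<psi>. test_function K \<psi> \<and> continuous_on {0..} \<psi> \<and> convex_on {0..} \<psi>"
    if moment
    using that truncated_identity_test_function unfolding moment_def by blast
  \<comment> \<open>From left to right: the ramp is a convex test function, and any such function
    yields a first moment bound, possibly with another \<open>M\<close>.\<close>
  have moment_iff: "moment \<longleftrightarrow> (\<exists>M\<ge>0. (SUP \<nu>\<in>K. \<integral>\<^sup>+s\<in>{M..}. ennreal s \<partial>\<nu>) < \<infinity>)"
    using moment_convex convex_moment first_moment_imp_truncated unfolding moment_def by meson
  have strict_tails: tails if "test_function K \<psi>" "strict_mono_on {0..} \<psi>" for \<psi>
    using strict_test_function_imp_finite_tails[OF K that] unfolding tails_def by blast
  have tails_strict: "\<exists>\<psi>. test_function K \<psi> \<and> continuous_on {0..} \<psi> \<and> strict_mono_on {0..} \<psi>"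
    if "tight_Rplus K" tails
  proof -
    obtain \<psi> where \<psi>: "test_function K \<psi>" "continuous_on {0..} \<psi>"
      using cont[OF \<open>tight_Rplus K\<close>] by blast
    \<comment> \<open>Bounded by \<open>1\<close> and strictly increasing, so the integral of the
      copy shifted by \<open>s\<close> is at most the mass of the tail beyond
      \<open>s\<close>.\<close>
    define g where "g t = t / (1 + t)" for t :: real
    obtain \<phi> where "test_function K \<phi>" "continuous_on {0..} \<phi>" "strict_mono_on {0..} \<phi>"
    proof (rule add_strict_mono_test_function[OF K \<psi>, of g])
      show "strict_mono_on {0..} g"
        by (rule strict_mono_onI) (simp add: g_def field_simps)
      show "continuous_on {0..} g"
        unfolding g_def by (intro continuous_intros) auto
      show "g 0 = 0" by (simp add: g_def)
      show "g t \<le> t" if "t \<ge> 0" for t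
        using that mult_nonneg_nonneg[OF that that] by (simp add: g_def field_simps)
      fix s :: real assume s: "s > 0"
      then obtain C where C: "C \<ge> 0" "\<And>\<nu>. \<nu> \<in> K \<Longrightarrow> emeasure \<nu> {s<..} \<le> ennreal C"
        using \<open>tails\<close> unfolding tails_def SUP_ennreal_less_top_iff by blast
      have "(\<integral>\<^sup>+x. ennreal (g (max (x - s) 0)) \<partial>\<nu>) \<le> ennreal C" if \<nu>: "\<nu> \<in> K" for \<nu>
      proof -
        have \<nu>': "\<nu> \<in> measures_Rplus" using \<nu> K by blast
        have "(\<integral>\<^sup>+x. ennreal (g (max (x - s) 0)) \<partial>\<nu>)
            \<le> (\<integral>\<^sup>+x. 0 \<partial>\<nu>) + ennreal 1 * emeasure \<nu> {s<..}"
          using s by (intro nn_integral_le_tail[OF \<nu>']) (auto simp: g_def indicator_def)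
        then show ?thesis using C(2)[OF \<nu>] by simp
      qed
      then show "\<exists>C\<ge>0. \<forall>\<nu>\<in>K. (\<integral>\<^sup>+x. ennreal (g (max (x - s) 0)) \<partial>\<nu>) \<le> ennreal C"
        using C(1) by blast
    qed
    then show ?thesis by blast
  qed
  have tails_convex_strict: "\<exists>\<psi>. test_function K \<psi> \<and> continuous_on {0..} \<psi> \<and>
      convex_on {0..} \<psi> \<and> strict_mono_on {0..} \<psi>"
    if moment tails
  proof -
    obtain M where M: "M \<ge> 0" "(SUP \<nu>\<in>K. \<integral>\<^sup>+s. ennreal (max (s - M) 0) \<partial>\<nu>) < \<infinity>"
      using \<open>moment\<close> unfolding moment_def by blast
    note \<psi> = truncated_identity_test_function[OF M]
    obtain B where B: "B \<ge> 0" "\<And>\<nu>. \<nu> \<in> K \<Longrightarrow> (\<integral>\<^sup>+s. ennreal (max (s - M) 0) \<partial>\<nu>) \<le> ennreal B"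
      using M(2) unfolding SUP_ennreal_less_top_iff by blast
    obtain \<phi> where "test_function K \<phi>" "continuous_on {0..} \<phi>" "strict_mono_on {0..} \<phi>"
      and "convex_on {0..} (\<lambda>s. max (s - M) 0) \<Longrightarrow> convex_on {0..} (\<lambda>t::real. t) \<Longrightarrow> convex_on {0..} \<phi>"
    \<comment> \<open>A bounded strictly increasing function on the half-line cannot be convex, so
      the identity takes the role of \<open>g\<close>.\<close>
    proof (rule add_strict_mono_test_function[OF K \<psi>(1,2), of "\<lambda>t. t"])
      fix s :: real assume s: "s > 0"
      then obtain C where C: "C \<ge> 0" "\<And>\<nu>. \<nu> \<in> K \<Longrightarrow> emeasure \<nu> {s<..} \<le> ennreal C"
        using \<open>tails\<close> unfolding tails_def SUP_ennreal_less_top_iff by blast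
      have "(\<integral>\<^sup>+x. ennreal (max (x - s) 0) \<partial>\<nu>) \<le> ennreal (B + M * C)" if \<nu>: "\<nu> \<in> K" for \<nu>
      proof -
        have \<nu>': "\<nu> \<in> measures_Rplus" using \<nu> K by blast
        have "(\<integral>\<^sup>+x. ennreal (max (x - s) 0) \<partial>\<nu>)
            \<le> (\<integral>\<^sup>+x. ennreal (max (x - M) 0) \<partial>\<nu>) + ennreal M * emeasure \<nu> {s<..}"
        proof (rule nn_integral_le_tail[OF \<nu>'])
          show "(\<lambda>x. ennreal (max (x - M) 0)) \<in> borel_measurable \<nu>"
            using measurable_measures_Rplus[OF \<nu>' \<psi>(2)] by simp
          \<comment> \<open>For \<open>x > s\<close> one has
            \<open>x - s < x \<le> max (x - M) 0 + M\<close>; for other \<open>x\<close> the left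
            side is \<open>0\<close>.\<close>
          show "ennreal (max (x - s) 0) \<le> ennreal (max (x - M) 0) + ennreal M * indicator {s<..} x"
            for x
            using s M(1)
            by (auto simp: indicator_def ennreal_plus[symmetric] simp del: ennreal_plus
                intro!: ennreal_leI)
        qed (use s M in auto)
        also have "\<dots> \<le> ennreal B + ennreal M * ennreal C"
          by (intro add_mono mult_left_mono B C \<nu>) simp
        also have "\<dots> = ennreal (B + M * C)"
          using B(1) C(1) M(1) by (simp add: ennreal_mult)
        finally show ?thesis .
      qed
      moreover have "B + M * C \<ge> 0" using B(1) C(1) M(1) by simp
      ultimately show "\<exists>C\<ge>0. \<forall>\<nu>\<in>K. (\<integral>\<^sup>+x. ennreal (max (x - s) 0) \<partial>\<nu>) \<le> ennreal C"
        by blast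
    qed (auto intro: strict_mono_onI continuous_on_id)
    moreover have "convex_on {0..} (\<lambda>t::real. t)" by (simp add: convex_on_def)
    ultimately show ?thesis using \<psi>(3) by blast
  qed
  show ?thesis
    \<comment> \<open>With both conditions folded into propositional constants, only logical
      combination of the facts above remains.\<close>
    unfolding moment_def[symmetric] tails_def[symmetric]
    using tight cont convex_moment moment_convex moment_iff strict_tails tails_strict
      tails_convex_strict
    by (intro conjI impI iffI) blast+
qed

end
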